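(* Let $\kappa\in(0,1)$ be fixed and let $\alpha$ be a real number. Let $X_1,X_2,\ldots$ be i.i.d. real random variables such that $|X_1|$ has an absolutely continuous distribution function $F(x)=\mathbb{P}\{|X_1|\le x\}$ with density $p$, where $p$ is positive and differentiable on $(0,\infty)$. For each $n\ge 2$ let $X_{(1)},\ldots,X_{(n)}$ denote the observations $X_1,\ldots,X_n$ ordered by their absolute values, from minimal to maximal. Suppose that (i) $p$ is regularly varying at infinity of index $-(\alpha+1)$; (ii) the function $$x\mapsto \frac{p'(x)}{\kappa\, p(\kappa x)}-\frac{p(x)\,p'(\kappa x)}{p^2(\kappa x)}$$ is integrable over $(0,\infty)$; (iii) for every $n\ge 2$, $$\lim_{x\to 0^+}F^{n}(\kappa x)\,\frac{p(x)}{p(\kappa x)}=0 .$$ Then $$\lim_{n\to\infty}\mathbb{P}\{|X_{(n-1)}|\le \kappa\,|X_{(n)}|\}=\kappa^{\alpha}.$$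
   Context: A function $p$ that is positive and measurable on $(0,\infty)$ is regularly varying at infinity of index $\rho\in\mathbb{R}$ if $\lim_{x\to\infty}p(tx)/p(x)=t^{\rho}$ for every $t>0$. $F^n(x)$ denotes the $n$-th power $(F(x))^n$. The ordering by absolute values means $|X_{(1)}|\le |X_{(2)}|\le\cdots\le|X_{(n)}|$, so that $|X_{(1)}|,\ldots,|X_{(n)}|$ are the order statistics of the sample $|X_1|,\ldots,|X_n|$. In the terminology of the paper, $X_{(n)}$ is called an outlier of order $1/\kappa$ when $|X_{(n-1)}|\le\kappa|X_{(n)}|$. *)

theory Defs
  imports "HOL-Probability.Probability"
begin

text \<open>Only the values of \<open>p\<close> on the open half-line matter.\<close>

definition regularly_varying :: "(real \<Rightarrow> real) \<Rightarrow> real \<Rightarrow> bool" where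
  "regularly_varying p \<rho> \<longleftrightarrow>
     (\<forall>x>0. p x > 0) \<and>
     p \<in> borel_measurable (restrict_space borel {0<..}) \<and>
     (\<forall>t>0. ((\<lambda>x. p (t * x) / p x) \<longlongrightarrow> t powr \<rho>) at_top)"

text \<open>
  \<open>abs_order_stat X n k\<close> is $X_{(k)}$: the \<open>k\<close>-th (counting from 1) of the first \<open>n\<close>
  observations \<open>X 0, \<dots>, X (n - 1)\<close>, ordered by absolute value from minimal to maximal;
  meaningful for $1 \le k \le n$.  The observation itself is returned, with its sign; ties
  in absolute value are broken by the index of the observation, as the sort is stable.
\<close>

definition abs_order_stat :: "(nat \<Rightarrow> 'a \<Rightarrow> real) \<Rightarrow> nat \<Rightarrow> nat \<Rightarrow> 'a \<Rightarrow> real" where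
  "abs_order_stat X n k \<omega> = sort_key abs (map (\<lambda>i. X i \<omega>) [0..<n]) ! (k - 1)"

end

theory Submission
  imports Defs "HOL-Combinatorics.Permutations"
begin

text \<open>
  An outlier occurs iff some single observation \<open>x\<close> exceeds all the others by the factor \<open>1 / \<kappa>\<close>,
  so the probability in question is \<open>n \<integral> p(x) F(\<kappa> x)\<^sup>n\<^sup>-\<^sup>1 dx = \<kappa>\<^sup>-\<^sup>1 \<integral> r(x) d(F(\<kappa> x)\<^sup>n)\<close> with
  \<open>r(x) = p(x) / p(\<kappa> x)\<close>.  Integration by parts turns this into
  \<open>\<kappa>\<^sup>-\<^sup>1 r(\<infinity>) - \<kappa>\<^sup>-\<^sup>1 \<integral> r'(x) F(\<kappa> x)\<^sup>n dx\<close>.  Regular variation yields \<open>r(\<infinity>) = \<kappa> powr (\<alpha> + 1)\<close>, and since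
  \<open>r'\<close> is integrable and \<open>F < 1\<close>, the last integral vanishes in the limit by dominated convergence.
\<close>

section \<open>The top two entries of a list sorted by absolute value\<close>

text \<open>Sorting only permutes the entries, so \<open>\<pi>\<close> carries a position in the
  sorted list \<open>s\<close> to an index of \<open>xs\<close>, and being dominated by a factor
  \<open>\<kappa>\<close> can be tested on either list. An entry dominating all others must sit at
  the last position, except in a degenerate case where everything vanishes; excluding ties this way
  is where \<open>\<kappa> < 1\<close> enters.\<close>

lemma top_two_sort_key_abs_iff:
  fixes xs :: "real list"
  assumes n: "length xs = n" "2 \<le> n" and \<kappa>: "0 < \<kappa>" "\<kappa> < 1"
  shows "\<bar>sort_key abs xs ! (n - 2)\<bar> \<le> \<kappa> * \<bar>sort_key abs xs ! (n - 1)\<bar> \<longleftrightarrow>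
    (\<exists>i<n. \<forall>j\<in>{..<n} - {i}. \<bar>xs ! j\<bar> \<le> \<kappa> * \<bar>xs ! i\<bar>)"
proof -
  define s where "s = sort_key abs xs"
  have "mset s = mset xs" by (simp add: s_def)
  then obtain \<pi> where \<pi>: "\<pi> permutes {..<length xs}" "permute_list \<pi> xs = s"
    by (rule mset_eq_permutation)
  have nth: "s ! k = xs ! \<pi> k" if "k < n" for k
    using permute_list_nth[OF \<pi>(1)] \<pi>(2) that n by auto
  have lt: "\<pi> k < n" if "k < n" for k
    using permutes_in_image[OF \<pi>(1)] that n by auto
  have surj: "\<exists>k<n. \<pi> k = j" if "j < n" for j
    using permutes_image[OF \<pi>(1)] that n by (metis imageE lessThan_iff)
  have inj: "\<pi> k = \<pi> l \<Longrightarrow> k = l" for k l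
    using permutes_inj[OF \<pi>(1)] by (auto dest: injD)
  have "sorted (map abs s)" by (simp add: s_def)
  then have mono: "\<bar>s ! k\<bar> \<le> \<bar>s ! l\<bar>" if "k \<le> l" "l < n" for k l
    using sorted_nth_mono[of "map abs s" k l] that n by (simp add: s_def)
  show ?thesis
    unfolding s_def[symmetric]
  proof
    assume top: "\<bar>s ! (n - 2)\<bar> \<le> \<kappa> * \<bar>s ! (n - 1)\<bar>"
    have "\<bar>xs ! j\<bar> \<le> \<kappa> * \<bar>xs ! \<pi> (n - 1)\<bar>" if j: "j < n" "j \<noteq> \<pi> (n - 1)" for j
    proof -
      obtain k where k: "k < n" "\<pi> k = j" using surj j by blast
      then have "k \<noteq> n - 1" using j by auto
      then have "\<bar>s ! k\<bar> \<le> \<bar>s ! (n - 2)\<bar>" using k n by (intro mono) auto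
      with top k n show ?thesis using nth[of k] nth[of "n - 1"] by simp
    qed
    then show "\<exists>i<n. \<forall>j\<in>{..<n} - {i}. \<bar>xs ! j\<bar> \<le> \<kappa> * \<bar>xs ! i\<bar>"
      using lt[of "n - 1"] n by (intro exI[of _ "\<pi> (n - 1)"]) auto
  next
    assume "\<exists>i<n. \<forall>j\<in>{..<n} - {i}. \<bar>xs ! j\<bar> \<le> \<kappa> * \<bar>xs ! i\<bar>"
    then obtain i where i: "i < n" "\<And>j. j < n \<Longrightarrow> j \<noteq> i \<Longrightarrow> \<bar>xs ! j\<bar> \<le> \<kappa> * \<bar>xs ! i\<bar>"
      by auto
    obtain m where m: "m < n" "\<pi> m = i" using surj i by blast
    have le: "\<bar>s ! k\<bar> \<le> \<kappa> * \<bar>s ! m\<bar>" if "k < n" "k \<noteq> m" for k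
      using i(2)[of "\<pi> k"] lt inj m that by (auto simp: nth)
    show "\<bar>s ! (n - 2)\<bar> \<le> \<kappa> * \<bar>s ! (n - 1)\<bar>"
    proof (cases "m = n - 1")
      case True
      then show ?thesis using le[of "n - 2"] n by auto
    next
      case False
      \<comment> \<open>The last entry is both dominated by entry \<open>m\<close> and at least as
        large in absolute value, so it is at most \<open>\<kappa>\<close> times itself. This forces
        it, and every entry below it, to be zero.\<close>
      then have "\<bar>s ! (n - 1)\<bar> \<le> \<kappa> * \<bar>s ! m\<bar>" using n by (intro le) auto
      also have "\<dots> \<le> \<kappa> * \<bar>s ! (n - 1)\<bar>"
        using m \<kappa> n by (intro mult_left_mono mono) auto
      finally have "(1 - \<kappa>) * \<bar>s ! (n - 1)\<bar> \<le> 0" by (simp add: algebra_simps)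
      then have "s ! (n - 1) = 0" using \<kappa> by (simp add: mult_le_0_iff)
      moreover have "\<bar>s ! (n - 2)\<bar> \<le> \<bar>s ! (n - 1)\<bar>" using n by (intro mono) auto
      ultimately show ?thesis by simp
    qed
  qed
qed

section \<open>One variable dominating independent others\<close>

text \<open>Condition on \<open>Y i\<close>. By independence the joint law of \<open>Y i\<close> and
  the remaining variables is a product measure; with \<open>Y i\<close> frozen at a value, the event
  asks every other variable to stay below a constant, so its probability is a product of
  distribution functions. Fubini then averages over \<open>Y i\<close>.\<close>

lemma (in prob_space) prob_scaled_dominates:
  fixes Y :: "'i \<Rightarrow> 'a \<Rightarrow> real"
  assumes ind: "indep_vars (\<lambda>_. borel) Y I" and fin: "finite I" and i: "i \<in> I"
  shows "prob {\<omega> \<in> space M. \<forall>j\<in>I - {i}. Y j \<omega> \<le> c * Y i \<omega>} =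
    expectation (\<lambda>\<omega>. \<Prod>j\<in>I - {i}. cdf (distr M borel (Y j)) (c * Y i \<omega>))"
proof (cases "I - {i} = {}")
  \<comment> \<open>With no other variable the event is the whole space and the empty product is 1.
    It is split off because the factorization below is over a nonempty index set.\<close>
  case True
  then show ?thesis by (simp only: True) (simp add: prob_space)
next
  case False
  define J where "J = I - {i}"
  have J: "J \<noteq> {}" "finite J" "J \<subseteq> I" using False fin by (auto simp: J_def)
  have rvI: "Y j \<in> borel_measurable M" if "j \<in> I" for j
    using ind that by (auto simp: indep_vars_def)
  have [measurable]: "Y i \<in> borel_measurable M" using rvI i by auto
  have [measurable]: "Y j \<in> borel_measurable M" if "j \<in> J" for j using rvI J that by auto
  define Z where "Z = (\<lambda>\<omega>. restrict (\<lambda>j. Y j \<omega>) J)"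
  let ?N = "PiM J (\<lambda>_. borel :: real measure)"
  have Z[measurable]: "Z \<in> measurable M ?N"
    unfolding Z_def by measurable
  \<comment> \<open>\<open>Y i\<close> is wrapped as a tuple with one coordinate, the form in which
    independence of disjoint blocks of the family is available.\<close>
  define W where "W = (\<lambda>\<omega>. restrict (\<lambda>j. Y j \<omega>) {i})"
  let ?L = "PiM {i} (\<lambda>_. borel :: real measure)"
  have W[measurable]: "W \<in> measurable M ?L"
    unfolding W_def by (intro measurable_restrict) simp
  have W_apply: "W \<omega> i = Y i \<omega>" for \<omega> by (simp add: W_def)
  have WZ: "indep_var ?L W ?N Z"
    unfolding W_def Z_def using i J by (intro indep_var_restrict[OF ind]) (auto simp: J_def)
  let ?D = "distr M ?L W" and ?E = "distr M ?N Z"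
  have prod: "?D \<Otimes>\<^sub>M ?E = distr M (?L \<Otimes>\<^sub>M ?N) (\<lambda>\<omega>. (W \<omega>, Z \<omega>))"
    using WZ by (simp add: indep_var_distribution_eq)
  interpret E: prob_space ?E by (rule prob_space_distr) simp
  define A where "A = {z \<in> space (?L \<Otimes>\<^sub>M ?N). \<forall>j\<in>J. snd z j \<le> c * fst z i}"
  have A[measurable]: "A \<in> sets (?L \<Otimes>\<^sub>M ?N)"
    unfolding A_def
  proof (rule sets.sets_Collect_finite_All[OF _ J(2)])
    fix j assume "j \<in> J"
    then have [measurable]: "(\<lambda>z. snd z j) \<in> borel_measurable (?L \<Otimes>\<^sub>M ?N)"
      by (intro measurable_compose[OF measurable_snd measurable_component_singleton])
    have [measurable]: "(\<lambda>z. fst z i) \<in> borel_measurable (?L \<Otimes>\<^sub>M ?N)"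
      by (intro measurable_compose[OF measurable_fst measurable_component_singleton]) simp
    show "{z \<in> space (?L \<Otimes>\<^sub>M ?N). snd z j \<le> c * fst z i} \<in> sets (?L \<Otimes>\<^sub>M ?N)"
      by measurable
  qed
  define G where "G = (\<lambda>x. \<Prod>j\<in>J. cdf (distr M borel (Y j)) (c * x))"
  have cdfm[measurable]: "cdf (distr M borel (Y j)) \<in> borel_measurable borel" if "j \<in> J" for j
  proof -
    interpret j: real_distribution "distr M borel (Y j)"
      using that by (intro real_distribution_distr) simp
    show ?thesis
      by (intro borel_measurable_mono monoI j.cdf_nondecreasing)
  qed
  have Gm[measurable]: "G \<in> borel_measurable borel"
    unfolding G_def by measurable
  have G0: "0 \<le> G x" for x
    unfolding G_def by (intro prod_nonneg ballI) (simp add: cdf_def)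
  have G1: "G x \<le> 1" for x
    unfolding G_def
  proof (intro prod_le_1 ballI conjI)
    fix j assume "j \<in> J"
    then interpret j: prob_space "distr M borel (Y j)" by (intro prob_space_distr) simp
    show "0 \<le> cdf (distr M borel (Y j)) (c * x)" "cdf (distr M borel (Y j)) (c * x) \<le> 1"
      by (simp_all add: cdf_def)
  qed
  \<comment> \<open>The slice of \<open>A\<close> over a fixed first coordinate is a box of
    half-lines, on which independence factorizes the probability.\<close>
  have slice: "emeasure ?E (Pair x -` A) = ennreal (G (x i))" if "x \<in> space ?L" for x
  proof -
    have "emeasure ?E (Pair x -` A) = emeasure M (Z -` (Pair x -` A) \<inter> space M)"
      by (intro emeasure_distr) (use sets_Pair1[OF A] in auto)
    also have "Z -` (Pair x -` A) \<inter> space M = (\<Inter>j\<in>J. Y j -` {..c * x i} \<inter> space M)"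
      using J measurable_space[OF Z] that by (auto simp: A_def Z_def space_pair_measure)
    also have "emeasure M \<dots> = ennreal (\<Prod>j\<in>J. prob (Y j -` {..c * x i} \<inter> space M))"
      unfolding emeasure_eq_measure using J
      by (intro arg_cong[where f = ennreal] indep_varsD[OF ind]) auto
    also have "(\<Prod>j\<in>J. prob (Y j -` {..c * x i} \<inter> space M)) = G (x i)"
      unfolding G_def by (intro prod.cong refl) (simp add: cdf_def measure_distr)
    finally show ?thesis .
  qed
  have "emeasure M {\<omega> \<in> space M. \<forall>j\<in>J. Y j \<omega> \<le> c * Y i \<omega>} =
      emeasure (distr M (?L \<Otimes>\<^sub>M ?N) (\<lambda>\<omega>. (W \<omega>, Z \<omega>))) A"
  proof (subst emeasure_distr)
    show "emeasure M {\<omega> \<in> space M. \<forall>j\<in>J. Y j \<omega> \<le> c * Y i \<omega>} =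
        emeasure M ((\<lambda>\<omega>. (W \<omega>, Z \<omega>)) -` A \<inter> space M)"
      by (intro arg_cong[where f = "emeasure M"])
        (auto simp: A_def W_def Z_def space_pair_measure space_PiM)
  qed measurable
  also have "\<dots> = (\<integral>\<^sup>+x. emeasure ?E (Pair x -` A) \<partial>?D)"
    by (subst prod[symmetric], rule E.emeasure_pair_measure_alt) simp
  also have "\<dots> = (\<integral>\<^sup>+x. ennreal (G (x i)) \<partial>?D)"
    by (intro nn_integral_cong) (simp add: slice)
  also have "\<dots> = (\<integral>\<^sup>+\<omega>. ennreal (G (Y i \<omega>)) \<partial>M)"
    by (subst nn_integral_distr[OF W]) (auto simp: W_apply)
  also have "\<dots> = ennreal (expectation (\<lambda>\<omega>. G (Y i \<omega>)))"
    by (intro nn_integral_eq_integral integrable_const_bound[where B = 1]) (auto simp: G0 G1)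
  finally have "prob {\<omega> \<in> space M. \<forall>j\<in>J. Y j \<omega> \<le> c * Y i \<omega>} = expectation (\<lambda>\<omega>. G (Y i \<omega>))"
    using G0 by (simp add: emeasure_eq_measure integral_nonneg_AE)
  then show ?thesis by (simp add: J_def G_def)
qed

text \<open>Two different indices cannot both dominate: \<open>Y j \<le> c * Y i\<close> and
  \<open>Y i \<le> c * Y j\<close> contradict positivity when \<open>c < 1\<close>. Since positivity
  holds almost surely, the events are disjoint up to null sets, and the probability of their union
  is the sum of the individual ones.\<close>

lemma (in prob_space) prob_some_scaled_dominates:
  fixes Y :: "'i \<Rightarrow> 'a \<Rightarrow> real"
  assumes ind: "indep_vars (\<lambda>_. borel) Y I" and fin: "finite I"
    and pos: "\<And>i. i \<in> I \<Longrightarrow> AE \<omega> in M. 0 < Y i \<omega>" and c: "0 < c" "c < 1"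
  shows "prob {\<omega> \<in> space M. \<exists>i\<in>I. \<forall>j\<in>I - {i}. Y j \<omega> \<le> c * Y i \<omega>} =
    (\<Sum>i\<in>I. expectation (\<lambda>\<omega>. \<Prod>j\<in>I - {i}. cdf (distr M borel (Y j)) (c * Y i \<omega>)))"
proof -
  define B where "B i = {\<omega> \<in> space M. \<forall>j\<in>I - {i}. Y j \<omega> \<le> c * Y i \<omega>}" for i
  have [measurable]: "Y j \<in> borel_measurable M" if "j \<in> I" for j
    using ind that by (auto simp: indep_vars_def)
  have Bm: "B i \<in> sets M" if "i \<in> I" for i
  proof -
    have [measurable]: "Y i \<in> borel_measurable M" using that by simp
    have "{\<omega> \<in> space M. Y j \<omega> \<le> c * Y i \<omega>} \<in> sets M" if "j \<in> I - {i}" for j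
    proof -
      have [measurable]: "Y j \<in> borel_measurable M" using that by simp
      show ?thesis by measurable
    qed
    then show ?thesis unfolding B_def using fin by (intro sets.sets_Collect_finite_All finite_Diff)
  qed
  have "AE \<omega> in M. \<omega> \<notin> B i \<or> \<omega> \<notin> B j" if ij: "i \<in> I" "j \<in> I" "i \<noteq> j" for i j
    using pos[OF ij(1)] pos[OF ij(2)]
  proof eventually_elim
    case (elim \<omega>)
    show ?case
    proof (rule ccontr)
      assume "\<not> ?thesis"
      then have "Y j \<omega> \<le> c * Y i \<omega>" "Y i \<omega> \<le> c * Y j \<omega>" using ij by (auto simp: B_def)
      moreover have "c * Y i \<omega> < Y i \<omega>" "c * Y j \<omega> < Y j \<omega>" using elim c by auto
      ultimately show False by linarith
    qed
  qed
  then have "prob (\<Union>i\<in>I. B i) = (\<Sum>i\<in>I. prob (B i))"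
    using fin Bm by (intro measure_UNION_AE) (auto simp: pairwise_def fmeasurable_eq_sets)
  moreover have "(\<Union>i\<in>I. B i) = {\<omega> \<in> space M. \<exists>i\<in>I. \<forall>j\<in>I - {i}. Y j \<omega> \<le> c * Y i \<omega>}"
    by (auto simp: B_def)
  ultimately show ?thesis
    using prob_scaled_dominates[OF ind fin] by (simp add: B_def)
qed

section \<open>Integration by parts on the half-line\<close>

text \<open>Exhaust the half-line by the compact intervals from \<open>1 / (k + 1)\<close> to
  \<open>k + 1\<close>, apply the fundamental theorem on each, and let \<open>k\<close> grow. On a
  compact interval the gauge integral recovers the increment of \<open>f\<close> from
  differentiability alone, and integrability of \<open>f'\<close> identifies it with the Lebesgue
  integral; no continuity of \<open>f'\<close> enters.\<close>

lemma LINT_Ioi_FTC: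
  fixes f f' :: "real \<Rightarrow> real"
  assumes deriv: "\<And>x. 0 < x \<Longrightarrow> (f has_real_derivative f' x) (at x)"
    and int: "set_integrable lborel {0<..} f'"
    and lim0: "(f \<longlongrightarrow> a) (at_right 0)" and lim: "(f \<longlongrightarrow> b) at_top"
  shows "(LINT x:{0<..}|lborel. f' x) = b - a"
proof -
  define l u :: "nat \<Rightarrow> real" where "l = (\<lambda>k. inverse (real (Suc k)))" and "u = (\<lambda>k. real (Suc k))"
  have Un: "(\<Union>k. {l k..u k}) = {0<..}"
  proof (intro equalityI subsetI)
    fix x :: real assume "x \<in> {0<..}"
    then have x: "0 < x" by simp
    obtain k1 where k1: "inverse (real (Suc k1)) < x" using reals_Archimedean[OF x] by blast
    obtain k2 where k2: "x < real k2" using reals_Archimedean2 by blast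
    have "inverse (real (Suc (max k1 k2))) \<le> inverse (real (Suc k1))" by (intro le_imp_inverse_le) auto
    with k1 have "l (max k1 k2) \<le> x" unfolding l_def by linarith
    moreover have "x \<le> u (max k1 k2)" using k2 by (simp add: u_def)
    ultimately have "x \<in> {l (max k1 k2)..u (max k1 k2)}" by simp
    then show "x \<in> (\<Union>k. {l k..u k})" by blast
  next
    fix x assume "x \<in> (\<Union>k. {l k..u k})"
    then obtain k where "l k \<le> x" by auto
    moreover have "0 < l k" by (simp add: l_def)
    ultimately show "x \<in> {0<..}" by simp
  qed
  have "incseq (\<lambda>k. {l k..u k})"
    by (auto simp: incseq_def l_def u_def intro: order_trans[OF le_imp_inverse_le])
  then have "(\<lambda>k. LINT x:{l k..u k}|lborel. f' x) \<longlonglongrightarrow> (LINT x:(\<Union>k. {l k..u k})|lborel. f' x)"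
    by (intro set_integral_cont_up) (use int Un in auto)
  moreover have "(LINT x:{l k..u k}|lborel. f' x) = f (u k) - f (l k)" for k
  proof -
    have pos: "0 < x" if "l k \<le> x" for x
      using less_le_trans[OF _ that, of 0] by (simp add: l_def)
    have le: "l k \<le> u k"
    proof -
      have "l k \<le> 1" by (simp add: l_def divide_simps)
      also have "1 \<le> u k" by (simp add: u_def)
      finally show ?thesis .
    qed
    have "set_integrable lborel {l k..u k} f'"
      by (rule set_integrable_subset[OF int]) (use pos in auto)
    then have "(LINT x:{l k..u k}|lborel. f' x) = integral {l k..u k} f'"
      by (rule set_borel_integral_eq_integral)
    also have "(f' has_integral (f (u k) - f (l k))) {l k..u k}"
      using le deriv pos
      by (intro fundamental_theorem_of_calculus)
        (auto simp flip: has_real_derivative_iff_has_vector_derivative intro: has_field_derivative_at_within)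
    then have "integral {l k..u k} f' = f (u k) - f (l k)" by (rule integral_unique)
    finally show ?thesis .
  qed
  moreover have "(\<lambda>k. f (u k) - f (l k)) \<longlonglongrightarrow> b - a"
  proof (intro tendsto_diff)
    have "filterlim u at_top sequentially"
      unfolding u_def by (rule filterlim_compose[OF filterlim_real_sequentially filterlim_Suc])
    then show "(\<lambda>k. f (u k)) \<longlonglongrightarrow> b" by (rule filterlim_compose[OF lim])
    have "l \<longlonglongrightarrow> 0" unfolding l_def by (rule LIMSEQ_inverse_real_of_nat)
    then have "filterlim l (at_right 0) sequentially"
      by (auto simp: filterlim_at l_def)
    then show "(\<lambda>k. f (l k)) \<longlonglongrightarrow> a" by (rule filterlim_compose[OF lim0])
  qed
  ultimately show ?thesis using Un LIMSEQ_unique by auto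
qed

text \<open>A density determines the derivative of its distribution function only almost everywhere;
  continuity of \<open>p\<close> upgrades this to every positive point. The argument is local: on
  the neighbourhood \<open>{x/2..2*x}\<close>, which stays away from 0, \<open>F\<close> is a
  constant plus an indefinite integral of \<open>p\<close>.\<close>

lemma increments_integral_imp_DERIV:
  fixes p :: "real \<Rightarrow> real"
  assumes int: "set_integrable lborel {0<..} p" and cont: "continuous_on {0<..} p"
    and incr: "\<And>a b. 0 < a \<Longrightarrow> a \<le> b \<Longrightarrow> F b - F a = (LINT x:{a..b}|lborel. p x)"
    and x: "0 < x"
  shows "(F has_real_derivative p x) (at x)"
proof -
  have sub: "{x/2..2*x} \<subseteq> {0<..}" using x by auto
  have "((\<lambda>y. integral {x/2..y} p) has_real_derivative p x) (at x within {x/2..2*x})"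
    using x by (intro integral_has_real_derivative continuous_on_subset[OF cont sub]) auto
  then have "((\<lambda>y. F (x/2) + integral {x/2..y} p) has_real_derivative p x) (at x within {x/2..2*x})"
    by (auto intro!: derivative_eq_intros)
  moreover have "F (x/2) + integral {x/2..y} p = F y" if "y \<in> {x/2..2*x}" for y
  proof -
    have "set_integrable lborel {x/2..y} p"
      by (rule set_integrable_subset[OF int]) (use x in auto)
    then show ?thesis
      using incr[of "x/2" y] x that by (auto dest: set_borel_integral_eq_integral(2))
  qed
  ultimately have "(F has_real_derivative p x) (at x within {x/2..2*x})"
    using x by (auto intro: has_field_derivative_transform_within[where d = 1, OF _ zero_less_one])
  then show ?thesis
    using x by (simp add: at_within_Icc_at)
qed

text \<open>Differentiating \<open>F (\<kappa> * x) ^ n\<close> produces a factor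
  \<open>p (\<kappa> * x)\<close>, which the ratio \<open>p x / p (\<kappa> * x)\<close> replaces by
  \<open>p x\<close>. Integrating the derivative of the product of the two therefore expresses the
  integral in question through boundary values and an error term that vanishes as \<open>n\<close>
  grows.\<close>

lemma scaled_power_integral_limit:
  fixes p F :: "real \<Rightarrow> real"
  assumes \<kappa>: "0 < \<kappa>"
    and p_pos: "\<And>x. 0 < x \<Longrightarrow> 0 < p x" and p_diff: "p differentiable_on {0<..}"
    and p_int: "set_integrable lborel {0<..} p"
    and F_deriv: "\<And>x. 0 < x \<Longrightarrow> (F has_real_derivative p x) (at x)"
    and F_mono: "mono F" and F0: "\<And>x. 0 \<le> F x" and F_lim: "(F \<longlongrightarrow> 1) at_top"
    and ratio: "((\<lambda>x. p x / p (\<kappa> * x)) \<longlongrightarrow> L) at_top"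
    and ratio_deriv: "set_integrable lborel {0<..}
      (\<lambda>x. deriv p x / (\<kappa> * p (\<kappa> * x)) - p x * deriv p (\<kappa> * x) / (p (\<kappa> * x))\<^sup>2)"
    and lim0: "\<And>n::nat. 2 \<le> n \<Longrightarrow>
      ((\<lambda>x. F (\<kappa> * x) ^ n * (p x / p (\<kappa> * x))) \<longlongrightarrow> 0) (at_right 0)"
  shows "(\<lambda>n. real n * (LINT x:{0<..}|lborel. p x * F (\<kappa> * x) ^ (n - 1))) \<longlonglongrightarrow> L / \<kappa>"
proof -
  \<comment> \<open>\<open>g\<close> is the derivative of \<open>p x / p (\<kappa> * x)\<close>
    divided by \<open>\<kappa>\<close>; in the second term this division cancels the chain rule
    factor.\<close>
  define g where
    "g x = deriv p x / (\<kappa> * p (\<kappa> * x)) - p x * deriv p (\<kappa> * x) / (p (\<kappa> * x))\<^sup>2" for x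
  have g_int: "set_integrable lborel {0<..} g"
    using ratio_deriv unfolding g_def .
  have F_le: "F x \<le> 1" for x
    by (rule tendsto_lowerbound[OF F_lim])
      (auto intro!: eventually_at_top_linorderI[of x] monoD[OF F_mono])
  \<comment> \<open>Positivity of \<open>p\<close> makes \<open>F\<close> strictly increasing to the
    right of \<open>x\<close>, so \<open>F x\<close> lies strictly below a value that is at most 1.
    Strictness is what makes the powers tend to 0.\<close>
  have F_less: "F x < 1" if "0 < x" for x
  proof -
    have "F x < F (x + 1)"
    proof (rule DERIV_pos_imp_increasing[of x "x + 1" F])
      fix y assume "x \<le> y"
      then show "\<exists>z. (F has_real_derivative z) (at y) \<and> 0 < z"
        using that F_deriv[of y] p_pos[of y] by auto
    qed simp
    with F_le show ?thesis using less_le_trans by blast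
  qed
  have Fm[measurable]: "F \<in> borel_measurable borel" using F_mono by (rule borel_measurable_mono)
  have F_pow_le: "F x ^ k \<le> 1" "0 \<le> F x ^ k" for x k
    using F0 F_le by (auto intro: power_le_one)
  have mult_int: "set_integrable lborel {0<..} (\<lambda>x. q x * F (\<kappa> * x) ^ k)"
    if q: "set_integrable lborel {0<..} q" for q :: "real \<Rightarrow> real" and k
    unfolding set_integrable_def
  proof (rule Bochner_Integration.integrable_bound[OF q[unfolded set_integrable_def]])
    have [measurable]: "(\<lambda>x. indicator {0<..} x *\<^sub>R q x) \<in> borel_measurable lborel"
      using q unfolding set_integrable_def by (rule borel_measurable_integrable)
    have "(\<lambda>x. (indicator {0<..} x *\<^sub>R q x) * F (\<kappa> * x) ^ k) \<in> borel_measurable lborel"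
      by measurable
    then show "(\<lambda>x. indicator {0<..} x *\<^sub>R (q x * F (\<kappa> * x) ^ k)) \<in> borel_measurable lborel"
      by (simp add: mult.assoc)
    show "AE x in lborel. norm (indicator {0<..} x *\<^sub>R (q x * F (\<kappa> * x) ^ k))
        \<le> norm (indicator {0<..} x *\<^sub>R q x)"
      using F_pow_le by (auto simp: abs_mult indicator_def intro!: mult_left_le)
  qed
  have p_deriv: "(p has_real_derivative deriv p x) (at x)" if "0 < x" for x
    using p_diff that
    by (simp add: DERIV_deriv_iff_real_differentiable differentiable_on_eq_differentiable_at)
  have by_parts: "real n * (LINT x:{0<..}|lborel. p x * F (\<kappa> * x) ^ (n - 1)) =
      L / \<kappa> - (LINT x:{0<..}|lborel. g x * F (\<kappa> * x) ^ n)" if n: "2 \<le> n" for n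
  proof -
    define h where "h x = \<kappa> * (g x * F (\<kappa> * x) ^ n) + \<kappa> * real n * (p x * F (\<kappa> * x) ^ (n - 1))" for x
    have ints: "set_integrable lborel {0<..} (\<lambda>x. \<kappa> * (g x * F (\<kappa> * x) ^ n))"
      "set_integrable lborel {0<..} (\<lambda>x. \<kappa> * real n * (p x * F (\<kappa> * x) ^ (n - 1)))"
      by (intro set_integrable_mult_right mult_int g_int p_int)+
    \<comment> \<open>\<open>h\<close> is the derivative of
      \<open>F (\<kappa> * x) ^ n * (p x / p (\<kappa> * x))\<close>. At infinity the power tends to
      1 and the ratio to \<open>L\<close>; at 0 the product vanishes by \<open>lim0\<close>, which
      is available for \<open>n \<ge> 2\<close>.\<close>
    have "(LINT x:{0<..}|lborel. h x) = L - 0"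
    proof (rule LINT_Ioi_FTC)
      fix x :: real assume x: "0 < x"
      then have kx: "0 < \<kappa> * x" using \<kappa> by simp
      have p0: "p (\<kappa> * x) \<noteq> 0" using p_pos[OF kx] by simp
      have dk: "((\<lambda>x. \<kappa> * x) has_real_derivative \<kappa>) (at x)"
        by (auto intro!: derivative_eq_intros)
      note [derivative_intros] = DERIV_chain2[OF p_deriv[OF kx] dk] DERIV_chain2[OF F_deriv[OF kx] dk]
        p_deriv[OF x]
      show "((\<lambda>x. F (\<kappa> * x) ^ n * (p x / p (\<kappa> * x))) has_real_derivative h x) (at x)"
        using p0 \<kappa> unfolding h_def g_def
        by (auto intro!: derivative_eq_intros simp: divide_simps)
          (simp add: algebra_simps power2_eq_square)
    next
      show "set_integrable lborel {0<..} h"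
        unfolding h_def by (rule set_integral_add[OF ints])
      have "filterlim (\<lambda>x. \<kappa> * x) at_top at_top"
        using \<kappa> by (intro filterlim_tendsto_pos_mult_at_top[OF tendsto_const]) (auto intro: filterlim_ident)
      then have "((\<lambda>x. F (\<kappa> * x)) \<longlongrightarrow> 1) at_top" by (rule filterlim_compose[OF F_lim])
      then have "((\<lambda>x. F (\<kappa> * x) ^ n * (p x / p (\<kappa> * x))) \<longlongrightarrow> 1 ^ n * L) at_top"
        by (intro tendsto_intros ratio)
      then show "((\<lambda>x. F (\<kappa> * x) ^ n * (p x / p (\<kappa> * x))) \<longlongrightarrow> L) at_top" by simp
    qed (rule lim0[OF n])
    also have "(LINT x:{0<..}|lborel. h x) = \<kappa> * (LINT x:{0<..}|lborel. g x * F (\<kappa> * x) ^ n) +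
        \<kappa> * real n * (LINT x:{0<..}|lborel. p x * F (\<kappa> * x) ^ (n - 1))"
      unfolding h_def by (simp only: set_integral_add(2)[OF ints] set_integral_mult_right)
    finally show ?thesis using \<kappa> by (simp add: field_simps)
  qed
  \<comment> \<open>Dominated convergence with majorant \<open>\<bar>g\<bar>\<close>: the powers are
    bounded by 1 and tend to 0 at every positive \<open>x\<close>.\<close>
  have "(\<lambda>n. LINT x:{0<..}|lborel. g x * F (\<kappa> * x) ^ n) \<longlonglongrightarrow> (LINT x:{0<..}|(lborel :: real measure). 0 :: real)"
    unfolding set_lebesgue_integral_def
  proof (rule integral_dominated_convergence[where w = "\<lambda>x. \<bar>indicator {0<..} x *\<^sub>R g x\<bar>"])
    show "(\<lambda>x. indicator {0<..} x *\<^sub>R (g x * F (\<kappa> * x) ^ n)) \<in> borel_measurable lborel" for n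
      using mult_int[OF g_int] unfolding set_integrable_def by (rule borel_measurable_integrable)
    show "integrable lborel (\<lambda>x. \<bar>indicator {0<..} x *\<^sub>R g x\<bar>)"
      using g_int unfolding set_integrable_def by (rule integrable_abs)
    show "AE x in lborel. norm (indicator {0<..} x *\<^sub>R (g x * F (\<kappa> * x) ^ n))
        \<le> \<bar>indicator {0<..} x *\<^sub>R g x\<bar>" for n
      using F_pow_le by (auto simp: abs_mult indicator_def intro!: mult_left_le)
    show "AE x in lborel. (\<lambda>n. indicator {0<..} x *\<^sub>R (g x * F (\<kappa> * x) ^ n)) \<longlonglongrightarrow> indicator {0<..} x *\<^sub>R 0"
    proof (intro AE_I2)
      fix x :: real
      show "(\<lambda>n. indicator {0<..} x *\<^sub>R (g x * F (\<kappa> * x) ^ n)) \<longlonglongrightarrow> indicator {0<..} x *\<^sub>R 0"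
      proof (cases "0 < x")
        case True
        then have "(\<lambda>n. F (\<kappa> * x) ^ n) \<longlonglongrightarrow> 0"
          using \<kappa> F0 F_less by (intro LIMSEQ_power_zero) auto
        then show ?thesis using True by (simp add: tendsto_mult_right_zero)
      qed simp
    qed
  qed simp
  then have "(\<lambda>n. L / \<kappa> - (LINT x:{0<..}|lborel. g x * F (\<kappa> * x) ^ n)) \<longlonglongrightarrow> L / \<kappa> - 0"
    by (intro tendsto_diff) auto
  then have "(\<lambda>n. L / \<kappa> - (LINT x:{0<..}|lborel. g x * F (\<kappa> * x) ^ n)) \<longlonglongrightarrow> L / \<kappa>"
    by simp
  then show ?thesis
    by (rule Lim_transform_eventually) (intro eventually_sequentiallyI[of 2], simp only: by_parts)
qed

theorem theorem2p1:
  fixes M :: "'a measure"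
    and X :: "nat \<Rightarrow> 'a \<Rightarrow> real"
    and F p :: "real \<Rightarrow> real"
    and \<kappa> \<alpha> :: real
  assumes "prob_space M"
    and "0 < \<kappa>" and "\<kappa> < 1"
    and indep: "prob_space.indep_vars M (\<lambda>_. borel) X UNIV"
    and ident: "\<And>i. distr M borel (X i) = distr M borel (X 0)"
    and F: "\<And>x. F x = measure M {\<omega> \<in> space M. \<bar>X 0 \<omega>\<bar> \<le> x}"
    and dens: "distributed M lborel (\<lambda>\<omega>. \<bar>X 0 \<omega>\<bar>) (\<lambda>x. ennreal (indicator {0<..} x * p x))"
    and p_pos: "\<And>x. x > 0 \<Longrightarrow> p x > 0"
    and p_diff: "p differentiable_on {0<..}"
    and i: "regularly_varying p (- (\<alpha> + 1))"
    and ii: "set_integrable lborel {0<..}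
      (\<lambda>x. deriv p x / (\<kappa> * p (\<kappa> * x)) - p x * deriv p (\<kappa> * x) / (p (\<kappa> * x))^2)"
    and iii: "\<And>n::nat. n \<ge> 2 \<Longrightarrow>
      ((\<lambda>x. F (\<kappa> * x) ^ n * (p x / p (\<kappa> * x))) \<longlongrightarrow> 0) (at_right 0)"
  shows "(\<lambda>n. measure M {\<omega> \<in> space M.
            \<bar>abs_order_stat X n (n - 1) \<omega>\<bar> \<le> \<kappa> * \<bar>abs_order_stat X n n \<omega>\<bar>})
         \<longlonglongrightarrow> \<kappa> powr \<alpha>"
proof -
  interpret prob_space M by fact
  note \<kappa> = \<open>0 < \<kappa>\<close> \<open>\<kappa> < 1\<close>

  \<comment> \<open>The common law of the absolute values\<close>
  define Y where "Y = (\<lambda>j \<omega>. \<bar>X j \<omega>\<bar>)"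
  define D where "D = distr M borel (Y 0)"
  define d where "d x = indicator {0<..} x * p x" for x
  have d0: "0 \<le> d x" for x using p_pos by (auto simp: d_def indicator_def intro: less_imp_le)
  have Xm[measurable]: "X j \<in> borel_measurable M" for j
    using indep by (auto simp: indep_vars_def)
  have Ym[measurable]: "Y j \<in> borel_measurable M" for j unfolding Y_def by measurable
  have Y_ind: "indep_vars (\<lambda>_. borel) Y J" for J
    unfolding Y_def
    by (intro indep_vars_compose2[where Y = "\<lambda>_. abs" and M' = "\<lambda>_. borel"] indep_vars_subset[OF indep]) auto
  have Y_distr: "distr M borel (Y j) = D" for j
  proof -
    have "distr M borel (Y j) = distr (distr M borel (X j)) borel abs" for j
      by (subst distr_distr) (auto simp: Y_def comp_def)
    then show ?thesis using ident[of j] by (simp add: D_def)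
  qed
  have dY: "distributed M lborel (Y 0) (\<lambda>x. ennreal (d x))"
    using dens by (simp add: Y_def d_def)
  have dm[measurable]: "d \<in> borel_measurable lborel"
    using distributed_real_measurable[OF _ dY] d0 by simp
  have D_eq: "D = density lborel (\<lambda>x. ennreal (d x))"
    using distributed_distr_eq_density[OF dY] by (simp add: D_def cong: distr_cong)
  interpret D: real_distribution D unfolding D_def by (rule real_distribution_distr) simp
  have F_cdf: "F = cdf D"
    by (auto simp: F cdf_def D_def measure_distr Y_def fun_eq_iff vimage_def intro!: arg_cong[where f = "measure M"])
  have d_nn: "(\<integral>\<^sup>+x. ennreal (d x) \<partial>lborel) = 1"
    using D.emeasure_space_1 unfolding D_eq by (simp add: emeasure_density)
  have d_int: "integrable lborel d"
    by (rule integrableI_nonneg) (use d0 d_nn in auto)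
  have p_int: "set_integrable lborel {0<..} p"
    using d_int unfolding set_integrable_def d_def by simp

  \<comment> \<open>The distribution function as an antiderivative of the density\<close>
  have F_diff: "F b - F a = (LINT x:{a..b}|lborel. p x)" if "0 < a" "a \<le> b" for a b
  proof -
    have "F b - F a = measure D {a<..b}"
    proof (cases "a < b")
      case True
      then show ?thesis by (simp add: F_cdf D.cdf_diff_eq)
    qed (use that in simp)
    also have "\<dots> = (LINT x|lborel. indicator {a<..b} x * d x)"
    proof -
      have "emeasure D {a<..b} = (\<integral>\<^sup>+x. ennreal (indicator {a<..b} x * d x) \<partial>lborel)"
        unfolding D_eq by (subst emeasure_density) (auto intro!: nn_integral_cong simp: indicator_def)
      also have "\<dots> = ennreal (LINT x|lborel. indicator {a<..b} x * d x)"
        using d0 integrable_real_mult_indicator[OF _ d_int, of "{a<..b}"]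
        by (intro nn_integral_eq_integral) (auto simp: mult.commute)
      finally show ?thesis
        using d0 by (simp add: D.emeasure_eq_measure integral_nonneg_AE)
    qed
    also have "\<dots> = (LINT x:{a..b}|lborel. p x)"
      unfolding set_lebesgue_integral_def
    proof (rule integral_cong_AE)
      have "(\<lambda>x. indicator {a..b} x *\<^sub>R d x) \<in> borel_measurable lborel" by measurable
      also have "(\<lambda>x. indicator {a..b} x *\<^sub>R d x) = (\<lambda>x. indicator {a..b} x *\<^sub>R p x)"
        using that by (auto simp: d_def indicator_def)
      finally show "(\<lambda>x. indicator {a..b} x *\<^sub>R p x) \<in> borel_measurable lborel" .
      \<comment> \<open>The two integrands differ at most at the endpoint \<open>a\<close>, a null
        set; since \<open>0 < a\<close>, \<open>d\<close> agrees with \<open>p\<close> on the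
        interval.\<close>
      show "AE x in lborel. indicator {a<..b} x * d x = indicator {a..b} x *\<^sub>R p x"
        using AE_lborel_singleton[of a]
        by eventually_elim (use that in \<open>auto simp: d_def indicator_def\<close>)
    qed measurable
    finally show ?thesis .
  qed
  have F_deriv: "(F has_real_derivative p x) (at x)" if "0 < x" for x
    using p_int differentiable_imp_continuous_on[OF p_diff] F_diff that
    by (rule increments_integral_imp_DERIV)

  \<comment> \<open>Regular variation and the limit of the integrals\<close>
  have ratio: "((\<lambda>x. p x / p (\<kappa> * x)) \<longlongrightarrow> \<kappa> powr (\<alpha> + 1)) at_top"
  proof -
    \<comment> \<open>Regular variation at \<open>t = \<kappa>\<close> gives the reciprocal of the
      wanted ratio.\<close>
    have "((\<lambda>x. p (\<kappa> * x) / p x) \<longlongrightarrow> \<kappa> powr (- (\<alpha> + 1))) at_top"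
      using i \<kappa> by (auto simp: regularly_varying_def)
    then have "((\<lambda>x. inverse (p (\<kappa> * x) / p x)) \<longlongrightarrow> inverse (\<kappa> powr (- (\<alpha> + 1)))) at_top"
      by (rule tendsto_inverse) (use \<kappa> in auto)
    then show ?thesis by (simp add: add.commute flip: powr_minus)
  qed
  have lim: "(\<lambda>n. real n * (LINT x:{0<..}|lborel. p x * F (\<kappa> * x) ^ (n - 1)))
      \<longlonglongrightarrow> \<kappa> powr (\<alpha> + 1) / \<kappa>"
    using \<kappa>(1) p_pos p_diff p_int F_deriv _ _ _ ratio ii iii
  proof (rule scaled_power_integral_limit)
    show "mono F" unfolding F_cdf by (intro monoI D.cdf_nondecreasing)
    show "0 \<le> F x" for x by (simp add: F)
    show "(F \<longlongrightarrow> 1) at_top" unfolding F_cdf by (rule D.cdf_lim_at_top_prob)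
  qed
  have pos: "AE \<omega> in M. 0 < Y j \<omega>" for j
  proof -
    have "AE x in D. 0 < x"
      unfolding D_eq by (subst AE_density) (measurable, auto simp: d_def indicator_def)
    then have "AE x in distr M borel (Y j). 0 < x" unfolding Y_distr .
    then show ?thesis by (rule AE_distrD[OF Ym])
  qed

  \<comment> \<open>The outlier probability as an integral\<close>
  have prob_eq: "prob {\<omega> \<in> space M. \<bar>abs_order_stat X n (n - 1) \<omega>\<bar> \<le> \<kappa> * \<bar>abs_order_stat X n n \<omega>\<bar>} =
      real n * (LINT x:{0<..}|lborel. p x * F (\<kappa> * x) ^ (n - 1))" if n: "2 \<le> n" for n
  proof -
    have Fm[measurable]: "F \<in> borel_measurable borel"
      unfolding F_cdf by (intro borel_measurable_mono monoI D.cdf_nondecreasing)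
    have "\<bar>abs_order_stat X n (n - 1) \<omega>\<bar> \<le> \<kappa> * \<bar>abs_order_stat X n n \<omega>\<bar> \<longleftrightarrow>
        (\<exists>i\<in>{..<n}. \<forall>j\<in>{..<n} - {i}. Y j \<omega> \<le> \<kappa> * Y i \<omega>)" for \<omega>
    proof -
      define xs where "xs = map (\<lambda>i. X i \<omega>) [0..<n]"
      \<comment> \<open>Order statistics count from 1 and list positions from 0, so the second
        largest observation sits at position \<open>n - 2\<close>.\<close>
      have "n - 1 - 1 = n - 2" by simp
      then have "\<bar>abs_order_stat X n (n - 1) \<omega>\<bar> \<le> \<kappa> * \<bar>abs_order_stat X n n \<omega>\<bar> \<longleftrightarrow>
          (\<exists>i<n. \<forall>j\<in>{..<n} - {i}. \<bar>xs ! j\<bar> \<le> \<kappa> * \<bar>xs ! i\<bar>)"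
        unfolding abs_order_stat_def xs_def[symmetric]
        using top_two_sort_key_abs_iff[of xs n \<kappa>] n \<kappa> by (simp only: xs_def length_map length_upt)
      also have "\<dots> \<longleftrightarrow> (\<exists>i\<in>{..<n}. \<forall>j\<in>{..<n} - {i}. Y j \<omega> \<le> \<kappa> * Y i \<omega>)"
        unfolding xs_def Y_def Bex_def Ball_def by (simp cong: conj_cong)
      finally show ?thesis .
    qed
    then have "prob {\<omega> \<in> space M. \<bar>abs_order_stat X n (n - 1) \<omega>\<bar> \<le> \<kappa> * \<bar>abs_order_stat X n n \<omega>\<bar>} =
        (\<Sum>i<n. expectation (\<lambda>\<omega>. \<Prod>j\<in>{..<n} - {i}. cdf (distr M borel (Y j)) (\<kappa> * Y i \<omega>)))"
      using prob_some_scaled_dominates[OF Y_ind finite_lessThan pos \<kappa>] by simp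
    \<comment> \<open>All variables share the law \<open>D\<close>, so each product consists of
      \<open>n - 1\<close> equal factors and the summands do not depend on \<open>i\<close>.\<close>
    also have "\<dots> = (\<Sum>i<n. LINT x:{0<..}|lborel. p x * F (\<kappa> * x) ^ (n - 1))"
    proof (rule sum.cong[OF refl])
      fix i assume i: "i \<in> {..<n}"
      have "expectation (\<lambda>\<omega>. \<Prod>j\<in>{..<n} - {i}. cdf (distr M borel (Y j)) (\<kappa> * Y i \<omega>)) =
          expectation (\<lambda>\<omega>. F (\<kappa> * Y i \<omega>) ^ (n - 1))"
        using i by (simp add: Y_distr F_cdf)
      also have "\<dots> = (LINT x|D. F (\<kappa> * x) ^ (n - 1))"
        unfolding Y_distr[of i, symmetric] by (subst integral_distr) auto
      also have "\<dots> = (LINT x|lborel. d x * F (\<kappa> * x) ^ (n - 1))"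
        unfolding D_eq using d0 by (subst integral_real_density) auto
      finally show "expectation (\<lambda>\<omega>. \<Prod>j\<in>{..<n} - {i}. cdf (distr M borel (Y j)) (\<kappa> * Y i \<omega>)) =
          (LINT x:{0<..}|lborel. p x * F (\<kappa> * x) ^ (n - 1))"
        by (simp add: set_lebesgue_integral_def d_def mult.assoc)
    qed
    finally show ?thesis by simp
  qed
  have "\<kappa> powr (\<alpha> + 1) / \<kappa> = \<kappa> powr \<alpha>" using \<kappa> by (simp add: powr_add)
  with lim have "(\<lambda>n. real n * (LINT x:{0<..}|lborel. p x * F (\<kappa> * x) ^ (n - 1))) \<longlonglongrightarrow> \<kappa> powr \<alpha>"
    by simp
  \<comment> \<open>The integral formula is established for \<open>n \<ge> 2\<close> only, where
    both order statistics have their intended meaning; this suffices for the limit.\<close>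
  then show ?thesis
    by (rule Lim_transform_eventually) (intro eventually_sequentiallyI[of 2], simp only: prob_eq)
qed

end
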